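(* Let $\mathcal{L}$ be the linear transformation $(\mathcal{L}u)_n=\sum_{j\in I}K(n,j)u_j$, $n\in I$, based on a matrix $K:I\times I\to\mathbb{R}$, $I\subseteq\mathbb{N}$. For $n\in\mathbb{N}$ define $v_{(n)}=\mathcal{L}^nu$, where $u$ is an arbitrary nonconstant real sequence. Given that $u-v_{(1)}$ is unimodal, the following hold: (i) if $\mathcal{L}$ is UP, then $v_{(n)}-v_{(n+1)}$ is unimodal; (ii) if $\mathcal{L}$ is UR, then $(-1)^n\{v_{(n)}-v_{(n+1)}\}$ is unimodal. Given that $K$ is positive, $u$ is nonnegative and $u/v_{(1)}$ (termwise quotient) is unimodal, the following hold: (iii) if $\mathcal{L}$ is UP, then $v_{(n)}/v_{(n+1)}$ is unimodal; (iv) if $\mathcal{L}$ is UR, then $(-1)^nv_{(n)}/v_{(n+1)}$ is unimodal.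
   Context: A kernel (matrix) $K$ is sign-regular of order $3$ ($SR_3$) if for each $k=1,2,3$ there is $\varepsilon_k\in\{-1,1\}$ with $\varepsilon_kd_k\ge0$ for every minor $d_k$ of $K$ of order $k$. A transformation $\mathcal{L}$ is unimodality-preserving if $\mathcal{L}u$ is unimodal for every real unimodal sequence $u$ for which $\mathcal{L}u$ is defined; it is unimodality-reversing if $-\mathcal{L}u$ is unimodal for every such $u$. UP (resp. UR) abbreviates: based on an $SR_3$ kernel and unimodality-preserving (resp. unimodality-reversing). Standing assumptions on the transformation: $K$ is bounded, for each $j$ the function $K(\cdot,j)$ attains its extremal values, $\sum_jK(n,j)<\infty$, and the sums defining the transformed sequences exist and are finite (converging uniformly). Unimodal sequence: $u=(u_1,u_2,\dots)$ is unimodal if it is constant, or there is a nonempty interval $[a^-,a^+]$ of positive integers such that $u_j\le u_{j+1}$ for $1\le j<a^-$, $u_j=u_{j+1}$ for $a^-\le j<a^+$, $u_j\ge u_{j+1}$ for $j\ge a^+$ (within the index range), and $u_{a^-}>\inf u$. *)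

theory Defs
  imports
    "HOL-Library.Extended_Real"
    "HOL-Analysis.Uniform_Limit"
    "Jordan_Normal_Form.Determinant"
begin

(* Sequences indexed by a set I of naturals are functions on nat of which only the
   values on I matter; likewise a matrix on I x I is a function of two naturals. *)

definition constant_seq :: "nat set \<Rightarrow> (nat \<Rightarrow> real) \<Rightarrow> bool" where
  "constant_seq I u \<longleftrightarrow> (\<exists>c. \<forall>j\<in>I. u j = c)"

(* j is the successor of i inside I, i.e. j = i + 1 when I is an interval. *)
definition next_in :: "nat set \<Rightarrow> nat \<Rightarrow> nat \<Rightarrow> bool" where
  "next_in I i j \<longleftrightarrow> i \<in> I \<and> j \<in> I \<and> i < j \<and> {i<..<j} \<inter> I = {}"

(* The infimum is taken in ereal because u may be unbounded below. *)
definition unimodal :: "nat set \<Rightarrow> (nat \<Rightarrow> real) \<Rightarrow> bool" where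
  "unimodal I u \<longleftrightarrow>
     constant_seq I u \<or>
     (\<exists>a\<in>I. \<exists>b\<in>I. a \<le> b \<and>
        (\<forall>i j. next_in I i j \<and> i < a \<longrightarrow> u i \<le> u j) \<and>
        (\<forall>i j. next_in I i j \<and> a \<le> i \<and> i < b \<longrightarrow> u i = u j) \<and>
        (\<forall>i j. next_in I i j \<and> b \<le> i \<longrightarrow> u i \<ge> u j) \<and>
        ereal (u a) > (INF j\<in>I. ereal (u j)))"

(* d is the k-th order minor of K on rows r 0 < ... < r (k-1), columns c 0 < ... < c (k-1). *)
definition is_minor :: "nat set \<Rightarrow> (nat \<Rightarrow> nat \<Rightarrow> real) \<Rightarrow> nat \<Rightarrow> real \<Rightarrow> bool" where
  "is_minor I K k d \<longleftrightarrow>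
     (\<exists>r c. strict_mono_on {..<k} r \<and> strict_mono_on {..<k} c \<and>
            r ` {..<k} \<subseteq> I \<and> c ` {..<k} \<subseteq> I \<and>
            d = Determinant.det (Matrix.mat k k (\<lambda>(a, b). K (r a) (c b))))"

definition SR3 :: "nat set \<Rightarrow> (nat \<Rightarrow> nat \<Rightarrow> real) \<Rightarrow> bool" where
  "SR3 I K \<longleftrightarrow>
     (\<forall>k\<in>{1, 2, 3}. \<exists>e\<in>{-1, 1::real}. \<forall>d. is_minor I K k d \<longrightarrow> e * d \<ge> 0)"

definition transf :: "nat set \<Rightarrow> (nat \<Rightarrow> nat \<Rightarrow> real) \<Rightarrow> (nat \<Rightarrow> real) \<Rightarrow> nat \<Rightarrow> real" where
  "transf I K u n = (\<Sum>j. if j \<in> I then K n j * u j else 0)"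

(* The sums exist, are finite, and converge uniformly in the row index. *)
definition transf_defined :: "nat set \<Rightarrow> (nat \<Rightarrow> nat \<Rightarrow> real) \<Rightarrow> (nat \<Rightarrow> real) \<Rightarrow> bool" where
  "transf_defined I K u \<longleftrightarrow>
     uniformly_convergent_on I (\<lambda>N n. \<Sum>j<N. if j \<in> I then K n j * u j else 0)"

definition admissible_kernel :: "nat set \<Rightarrow> (nat \<Rightarrow> nat \<Rightarrow> real) \<Rightarrow> bool" where
  "admissible_kernel I K \<longleftrightarrow>
     (\<exists>B. \<forall>n\<in>I. \<forall>j\<in>I. \<bar>K n j\<bar> \<le> B) \<and>
     (\<forall>j\<in>I. (\<exists>p\<in>I. \<forall>n\<in>I. K n j \<le> K p j) \<and> (\<exists>q\<in>I. \<forall>n\<in>I. K q j \<le> K n j)) \<and>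
     (\<forall>n\<in>I. summable (\<lambda>j. if j \<in> I then K n j else 0))"

definition unimodality_preserving :: "nat set \<Rightarrow> (nat \<Rightarrow> nat \<Rightarrow> real) \<Rightarrow> bool" where
  "unimodality_preserving I K \<longleftrightarrow>
     (\<forall>u. unimodal I u \<and> transf_defined I K u \<longrightarrow> unimodal I (transf I K u))"

definition unimodality_reversing :: "nat set \<Rightarrow> (nat \<Rightarrow> nat \<Rightarrow> real) \<Rightarrow> bool" where
  "unimodality_reversing I K \<longleftrightarrow>
     (\<forall>u. unimodal I u \<and> transf_defined I K u \<longrightarrow> unimodal I (\<lambda>n. - transf I K u n))"

definition UP :: "nat set \<Rightarrow> (nat \<Rightarrow> nat \<Rightarrow> real) \<Rightarrow> bool" where
  "UP I K \<longleftrightarrow> SR3 I K \<and> unimodality_preserving I K"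

definition UR :: "nat set \<Rightarrow> (nat \<Rightarrow> nat \<Rightarrow> real) \<Rightarrow> bool" where
  "UR I K \<longleftrightarrow> SR3 I K \<and> unimodality_reversing I K"

definition iterate :: "nat set \<Rightarrow> (nat \<Rightarrow> nat \<Rightarrow> real) \<Rightarrow> (nat \<Rightarrow> real) \<Rightarrow> nat \<Rightarrow> nat \<Rightarrow> real" where
  "iterate I K u n = (transf I K ^^ n) u"

end

theory Submission
  imports Defs
begin

text \<open>
  Differences are handled by linearity. For quotients put \<open>s = 1\<close> (UP) or \<open>s = -1\<close> (UR). Testing
  \<open>s L\<close> on unimodal step functions shows that every 3-minor has the sign of \<open>s\<close> times the common
  sign of the 2-minors. Hence \<open>s L f\<close> never has sign pattern \<open>(+,-,+)\<close> when \<open>f\<close> has pattern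
  \<open>(-,+,-)\<close>. If \<open>t w / L w\<close> is unimodal, \<open>f = t w - s c L w\<close> has that pattern for every \<open>c\<close>, so
  \<open>s t L w / L(L w)\<close> has no interior dip. It also attains its maximum,
  because all rows of the kernel beyond some index coincide.
\<close>

text \<open>\<open>SR3\<close> chooses a sign for each order separately and does not relate the
  3-minors to the 2-minors; that relation must come from testing the transformation on step
  functions. Such a test is legitimate only if bounded sequences have a transform, which is derived
  from the iterates: the first one is bounded below by a positive constant and so dominates the
  constants. Two further obstacles shape the proof. Minors may vanish, so the usual count of sign
  changes for strictly sign-regular kernels does not apply directly, and the degenerate case is
  settled by hand. Moreover, a unimodal sequence must attain its peak inside \<open>I\<close>: a
  sequence that increases strictly forever has no interior dip and yet is not unimodal. Attainment
  therefore needs an argument of its own. It exploits sequences that stay unimodal after a change of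
  sign, since their transforms have to become constant.\<close>

section \<open>Minors of order two and three in explicit form\<close>

definition det2 :: "(nat \<Rightarrow> real) \<Rightarrow> (nat \<Rightarrow> real) \<Rightarrow> nat \<Rightarrow> nat \<Rightarrow> real" where
  "det2 a b l m = a l * b m - a m * b l"

text \<open>Laplace expansion along the first column, on the rows \<open>l\<close>,
  \<open>m\<close>, \<open>n\<close>. Columns are arbitrary functions of the row, so that
  transformed sequences can take the place of columns of \<open>K\<close>.\<close>

definition det3 ::
    "(nat \<Rightarrow> real) \<Rightarrow> (nat \<Rightarrow> real) \<Rightarrow> (nat \<Rightarrow> real) \<Rightarrow> nat \<Rightarrow> nat \<Rightarrow> nat \<Rightarrow> real" where
  "det3 a b c l m n = a l * det2 b c m n - a m * det2 b c l n + a n * det2 b c l m"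

lemma det_mat_Suc:
  fixes f :: "nat \<times> nat \<Rightarrow> real"
  shows "Determinant.det (Matrix.mat (Suc n) (Suc n) f) =
    (\<Sum>i<Suc n. f (i, 0) * ((-1) ^ i *
       Determinant.det (Matrix.mat n n (\<lambda>(a, b). f (if a < i then a else Suc a, Suc b)))))"
proof -
  have "Determinant.det (Matrix.mat (Suc n) (Suc n) f) =
      (\<Sum>i<Suc n. Matrix.mat (Suc n) (Suc n) f $$ (i, 0)
         * cofactor (Matrix.mat (Suc n) (Suc n) f) i 0)"
    by (rule laplace_expansion_column) auto
  also have "\<dots> = (\<Sum>i<Suc n. f (i, 0) * ((-1) ^ i *
       Determinant.det (Matrix.mat n n (\<lambda>(a, b). f (if a < i then a else Suc a, Suc b)))))"
  proof (rule sum.cong[OF refl])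
    fix i assume "i \<in> {..<Suc n}"
    moreover have "mat_delete (Matrix.mat (Suc n) (Suc n) f) i 0 =
        Matrix.mat n n (\<lambda>(a, b). f (if a < i then a else Suc a, Suc b))"
      by (rule eq_matI) (auto simp: mat_delete_def)
    ultimately show "Matrix.mat (Suc n) (Suc n) f $$ (i, 0)
         * cofactor (Matrix.mat (Suc n) (Suc n) f) i 0 = f (i, 0) * ((-1) ^ i *
       Determinant.det (Matrix.mat n n (\<lambda>(a, b). f (if a < i then a else Suc a, Suc b))))"
      by (simp add: cofactor_def)
  qed
  finally show ?thesis .
qed

lemma det_mat_2:
  "Determinant.det (Matrix.mat 2 2 f) = f (0,0) * f (1,1) - f (1,0) * (f (0,1) :: real)"
  unfolding numeral_2_eq_2 by (simp add: det_mat_Suc)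

lemma det_mat_3:
  fixes f :: "nat \<times> nat \<Rightarrow> real"
  shows "Determinant.det (Matrix.mat 3 3 f) =
    f (0,0) * (f (1,1) * f (2,2) - f (2,1) * f (1,2))
    - f (1,0) * (f (0,1) * f (2,2) - f (2,1) * f (0,2))
    + f (2,0) * (f (0,1) * f (1,2) - f (1,1) * f (0,2))"
  unfolding numeral_3_eq_3 numeral_2_eq_2 by (simp add: det_mat_Suc algebra_simps)

lemma is_minor_2:
  assumes "l \<in> I" "m \<in> I" "i \<in> I" "j \<in> I" "l < m" "i < j"
  shows "is_minor I K 2 (det2 (\<lambda>n. K n i) (\<lambda>n. K n j) l m)"
  unfolding is_minor_def
  by (rule exI[of _ "\<lambda>a. if a = 0 then l else m"], rule exI[of _ "\<lambda>a. if a = 0 then i else j"])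
    (use assms in \<open>auto simp: strict_mono_on_def det2_def det_mat_2\<close>)

lemma is_minor_3:
  assumes "l \<in> I" "m \<in> I" "n \<in> I" "i \<in> I" "j \<in> I" "k \<in> I" "l < m" "m < n" "i < j" "j < k"
  shows "is_minor I K 3 (det3 (\<lambda>n. K n i) (\<lambda>n. K n j) (\<lambda>n. K n k) l m n)"
proof -
  define tri where "tri x y z a = (if a = 0 then x else if a = 1 then y else z)" for x y z a :: nat
  have tri: "tri x y z 0 = x" "tri x y z 1 = y" "tri x y z 2 = z" for x y z
    by (simp_all add: tri_def)
  have mono: "strict_mono_on {..<3} (tri x y z)" if "x < y" "y < z" for x y z
    using that by (auto simp: strict_mono_on_def tri_def)
  have sub: "tri x y z ` {..<3} \<subseteq> I" if "x \<in> I" "y \<in> I" "z \<in> I" for x y z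
    using that by (auto simp: tri_def)
  have det: "det3 (\<lambda>n. K n i) (\<lambda>n. K n j) (\<lambda>n. K n k) l m n =
      Determinant.det (Matrix.mat 3 3 (\<lambda>(a, b). K (tri l m n a) (tri i j k b)))"
    unfolding det_mat_3 prod.case tri det3_def det2_def by (simp only: mult.commute)
  show ?thesis
    unfolding is_minor_def
    by (rule exI[of _ "tri l m n"], rule exI[of _ "tri i j k"])
      (simp only: det mono sub assms simp_thms)
qed

lemma SR3_minors:
  assumes "SR3 I K"
  obtains e2 e3 :: real where "e2 \<in> {-1, 1}" "e3 \<in> {-1, 1}"
    "\<And>l m i j. \<lbrakk>l \<in> I; m \<in> I; i \<in> I; j \<in> I; l < m; i < j\<rbrakk>
       \<Longrightarrow> 0 \<le> e2 * det2 (\<lambda>n. K n i) (\<lambda>n. K n j) l m"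
    "\<And>l m n i j k. \<lbrakk>l \<in> I; m \<in> I; n \<in> I; i \<in> I; j \<in> I; k \<in> I; l < m; m < n; i < j; j < k\<rbrakk>
       \<Longrightarrow> 0 \<le> e3 * det3 (\<lambda>n. K n i) (\<lambda>n. K n j) (\<lambda>n. K n k) l m n"
proof -
  have minors: "\<exists>e\<in>{-1, 1::real}. \<forall>d. is_minor I K k d \<longrightarrow> e * d \<ge> 0" if "k \<in> {1, 2, 3}" for k
    using assms that unfolding SR3_def by blast
  have "2 \<in> {1, 2, 3::nat}" "3 \<in> {1, 2, 3::nat}" by simp_all
  then obtain e2 e3 where e2: "e2 \<in> {-1, 1::real}" "\<forall>d. is_minor I K 2 d \<longrightarrow> e2 * d \<ge> 0"
      and e3: "e3 \<in> {-1, 1::real}" "\<forall>d. is_minor I K 3 d \<longrightarrow> e3 * d \<ge> 0"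
    using minors by metis
  show thesis
  proof (rule that[OF e2(1) e3(1)])
    fix l m i j assume "l \<in> I" "m \<in> I" "i \<in> I" "j \<in> I" "l < m" "i < j"
    then show "0 \<le> e2 * det2 (\<lambda>n. K n i) (\<lambda>n. K n j) l m"
      by (intro e2(2)[rule_format] is_minor_2)
  next
    fix l m n i j k
    assume "l \<in> I" "m \<in> I" "n \<in> I" "i \<in> I" "j \<in> I" "k \<in> I" "l < m" "m < n" "i < j" "j < k"
    then show "0 \<le> e3 * det3 (\<lambda>n. K n i) (\<lambda>n. K n j) (\<lambda>n. K n k) l m n"
      by (intro e3(2)[rule_format] is_minor_3)
  qed
qed

section \<open>Determinants whose columns are transformed sequences\<close>

text \<open>By linearity the right-hand side is a series of nonnegative terms, so each term is a
  lower bound. A determinant is such a form in each of its columns; this allows columns of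
  \<open>K\<close> to be replaced by transforms one at a time.\<close>

lemma transf_linear_form_ge:
  fixes p q r :: real
  assumes summ: "\<And>i. i \<in> {l, m, n} \<Longrightarrow> summable (\<lambda>j. if j \<in> I then K i j * f j else 0)"
    and nonneg: "\<And>j. j \<in> I \<Longrightarrow> 0 \<le> f j * (p * K l j + q * K m j + r * K n j)"
    and "k \<in> I"
  shows "f k * (p * K l k + q * K m k + r * K n k)
    \<le> p * transf I K f l + q * transf I K f m + r * transf I K f n"
proof -
  let ?t = "\<lambda>i j. if j \<in> I then K i j * f j else 0"
  let ?g = "\<lambda>j. p * ?t l j + q * ?t m j + r * ?t n j"
  have g: "?g j = (if j \<in> I then f j * (p * K l j + q * K m j + r * K n j) else 0)" for j
    by (simp add: algebra_simps)
  have S: "?g sums (p * transf I K f l + q * transf I K f m + r * transf I K f n)"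
    unfolding transf_def by (intro sums_add sums_mult summable_sums summ) auto
  have T: "(\<lambda>j. if j = k then ?g j else 0) sums ?g k"
    by (rule sums_single)
  have "(if j = k then ?g j else 0) \<le> ?g j" for j
    unfolding g using nonneg[of j] by simp
  then have "?g k \<le> p * transf I K f l + q * transf I K f m + r * transf I K f n"
    by (rule sums_le[OF _ T S])
  then show ?thesis unfolding g using \<open>k \<in> I\<close> by simp
qed

text \<open>Bilinearity turns the determinant into a double series of 2-minors with weights
  \<open>f i * g j\<close>. As the support of \<open>f\<close> lies to the left of that of
  \<open>g\<close>, only minors with \<open>i < j\<close> carry weight.\<close>

lemma det2_transf_nonneg:
  assumes minors: "\<And>i j. \<lbrakk>i \<in> I; j \<in> I; i < j\<rbrakk> \<Longrightarrow> 0 \<le> e * det2 (\<lambda>n. K n i) (\<lambda>n. K n j) l m"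
    and rows: "l \<in> I" "m \<in> I"
    and f: "\<And>j. j \<in> I \<Longrightarrow> 0 \<le> f j" and g: "\<And>j. j \<in> I \<Longrightarrow> 0 \<le> g j"
    and fg: "\<And>i j. \<lbrakk>i \<in> I; j \<in> I; f i > 0; g j > 0\<rbrakk> \<Longrightarrow> i < j"
    and sf: "\<And>i. i \<in> {l, m} \<Longrightarrow> summable (\<lambda>j. if j \<in> I then K i j * f j else 0)"
    and sg: "\<And>i. i \<in> {l, m} \<Longrightarrow> summable (\<lambda>j. if j \<in> I then K i j * g j else 0)"
  shows "0 \<le> e * det2 (transf I K f) (transf I K g) l m"
proof -
  have 1: "0 \<le> f i * g j * (e * det2 (\<lambda>n. K n i) (\<lambda>n. K n j) l m)" if "i \<in> I" "j \<in> I" for i j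
  proof (cases "f i > 0 \<and> g j > 0")
    case True
    then have "i < j" using fg that by blast
    then show ?thesis by (intro mult_nonneg_nonneg[OF mult_nonneg_nonneg] minors f g that)
  next
    case False
    then have "f i = 0 \<or> g j = 0" using f[OF that(1)] g[OF that(2)] by linarith
    then show ?thesis by auto
  qed
  have 2: "0 \<le> f i * (e * det2 (\<lambda>n. K n i) (transf I K g) l m)" if i: "i \<in> I" for i
  proof -
    \<comment> \<open>The linear form has three rows; here the third is a dummy with coefficient
      0.\<close>
    have "g l * (- (f i * e * K m i) * K l l + f i * e * K l i * K m l + 0 * K m l)
      \<le> - (f i * e * K m i) * transf I K g l + f i * e * K l i * transf I K g m + 0 * transf I K g m"
    proof (rule transf_linear_form_ge[OF sg _ \<open>l \<in> I\<close>])
      fix j assume "j \<in> I"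
      from 1[OF i this]
      show "0 \<le> g j * (- (f i * e * K m i) * K l j + f i * e * K l i * K m j + 0 * K m j)"
        by (simp add: det2_def algebra_simps)
    qed auto
    with 1[OF i \<open>l \<in> I\<close>] show ?thesis by (simp add: det2_def algebra_simps)
  qed
  have "f l * (e * transf I K g m * K l l + - (e * transf I K g l) * K m l + 0 * K m l)
      \<le> e * transf I K g m * transf I K f l + - (e * transf I K g l) * transf I K f m
        + 0 * transf I K f m"
  proof (rule transf_linear_form_ge[OF sf _ \<open>l \<in> I\<close>])
    fix j assume "j \<in> I"
    from 2[OF this]
    show "0 \<le> f j * (e * transf I K g m * K l j + - (e * transf I K g l) * K m j + 0 * K m j)"
      by (simp add: det2_def algebra_simps)
  qed auto
  with 2[OF \<open>l \<in> I\<close>] show ?thesis by (simp add: det2_def algebra_simps)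
qed

text \<open>Trilinear counterpart of \<open>det2_transf_nonneg\<close>. The bound keeps one term of
  the triple series, so that a strict sign of a single minor passes to the transforms.\<close>

lemma det3_transf_ge:
  assumes minors: "\<And>i j k. \<lbrakk>i \<in> I; j \<in> I; k \<in> I; i < j; j < k\<rbrakk>
      \<Longrightarrow> 0 \<le> e * det3 (\<lambda>n. K n i) (\<lambda>n. K n j) (\<lambda>n. K n k) l m n"
    and f: "\<And>j. j \<in> I \<Longrightarrow> 0 \<le> f j" and g: "\<And>j. j \<in> I \<Longrightarrow> 0 \<le> g j"
    and h: "\<And>j. j \<in> I \<Longrightarrow> 0 \<le> h j"
    and fg: "\<And>i j. \<lbrakk>i \<in> I; j \<in> I; f i > 0; g j > 0\<rbrakk> \<Longrightarrow> i < j"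
    and gh: "\<And>i j. \<lbrakk>i \<in> I; j \<in> I; g i > 0; h j > 0\<rbrakk> \<Longrightarrow> i < j"
    and sf: "\<And>i. i \<in> {l, m, n} \<Longrightarrow> summable (\<lambda>j. if j \<in> I then K i j * f j else 0)"
    and sg: "\<And>i. i \<in> {l, m, n} \<Longrightarrow> summable (\<lambda>j. if j \<in> I then K i j * g j else 0)"
    and sh: "\<And>i. i \<in> {l, m, n} \<Longrightarrow> summable (\<lambda>j. if j \<in> I then K i j * h j else 0)"
    and cols: "i \<in> I" "j \<in> I" "k \<in> I"
  shows "f i * g j * h k * (e * det3 (\<lambda>n. K n i) (\<lambda>n. K n j) (\<lambda>n. K n k) l m n)
    \<le> e * det3 (transf I K f) (transf I K g) (transf I K h) l m n"
proof -
  let ?F = "transf I K f" and ?G = "transf I K g" and ?H = "transf I K h"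
  let ?c = "\<lambda>i n. K n i"
  have 0: "0 \<le> f i * g j * h k * (e * det3 (?c i) (?c j) (?c k) l m n)"
    if "i \<in> I" "j \<in> I" "k \<in> I" for i j k
  proof (cases "f i > 0 \<and> g j > 0 \<and> h k > 0")
    case True
    then have "i < j" "j < k" using fg gh that by blast+
    then show ?thesis
      by (intro mult_nonneg_nonneg[OF mult_nonneg_nonneg[OF mult_nonneg_nonneg]] minors f g h that)
  next
    case False
    then have "f i = 0 \<or> g j = 0 \<or> h k = 0" using f[OF that(1)] g[OF that(2)] h[OF that(3)] by linarith
    then show ?thesis by auto
  qed
  have 1: "f i * g j * h k * (e * det3 (?c i) (?c j) (?c k) l m n)
      \<le> f i * g j * (e * det3 (?c i) (?c j) ?H l m n)"
    if ijk: "i \<in> I" "j \<in> I" "k \<in> I" for i j k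
  proof -
    define w where "w = f i * g j * e"
    have eq: "f i * g j * (e * det3 (?c i) (?c j) z l m n) =
        w * det2 (?c i) (?c j) m n * z l + - (w * det2 (?c i) (?c j) l n) * z m
        + w * det2 (?c i) (?c j) l m * z n" for z
      by (simp add: w_def det3_def det2_def algebra_simps)
    have eq': "f i * g j * h k * (e * det3 (?c i) (?c j) z l m n) =
        h k * (f i * g j * (e * det3 (?c i) (?c j) z l m n))" for k z
      by simp
    show ?thesis unfolding eq'
      unfolding eq
      by (rule transf_linear_form_ge[OF sh 0[OF ijk(1,2), unfolded eq', unfolded eq] ijk(3)])
  qed
  have nonneg1: "0 \<le> f i * g j * (e * det3 (?c i) (?c j) ?H l m n)" if "i \<in> I" "j \<in> I" for i j
    using order.trans[OF 0 1] that by blast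
  have 2: "f i * g j * (e * det3 (?c i) (?c j) ?H l m n) \<le> f i * (e * det3 (?c i) ?G ?H l m n)"
    if ij: "i \<in> I" "j \<in> I" for i j
  proof -
    define w where "w = f i * e"
    have eq: "f i * (e * det3 (?c i) z ?H l m n) =
        - (w * det2 (?c i) ?H m n) * z l + w * det2 (?c i) ?H l n * z m
        + - (w * det2 (?c i) ?H l m) * z n" for z
      by (simp add: w_def det3_def det2_def algebra_simps)
    have eq': "f i * g j * (e * det3 (?c i) z ?H l m n) =
        g j * (f i * (e * det3 (?c i) z ?H l m n))" for j z
      by simp
    show ?thesis unfolding eq'
      unfolding eq
      by (rule transf_linear_form_ge[OF sg nonneg1[OF ij(1), unfolded eq', unfolded eq] ij(2)])
  qed
  have nonneg2: "0 \<le> f i * (e * det3 (?c i) ?G ?H l m n)" if "i \<in> I" for i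
    using order.trans[OF nonneg1 2] that by blast
  have 3: "f i * (e * det3 (?c i) ?G ?H l m n) \<le> e * det3 ?F ?G ?H l m n"
  proof -
    have eq: "e * det3 z ?G ?H l m n =
        e * det2 ?G ?H m n * z l + - (e * det2 ?G ?H l n) * z m + e * det2 ?G ?H l m * z n" for z
      by (simp add: det3_def algebra_simps)
    show ?thesis unfolding eq
      by (rule transf_linear_form_ge[OF sf nonneg2[unfolded eq] cols(1)])
  qed
  show ?thesis
    using 1[OF cols] 2[OF cols(1,2)] 3 by linarith
qed

section \<open>Unimodality expressed through an attained peak\<close>

text \<open>\<open>P\<close> and \<open>Q\<close> cut out the interval on which neighbours are
  comparable. Since \<open>I\<close> may have gaps, the induction on \<open>j - i\<close> passes to
  the least element of \<open>I\<close> above \<open>i\<close>.\<close>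

lemma next_in_chain:
  assumes trans: "\<And>x y z. \<lbrakk>R x y; R y z\<rbrakk> \<Longrightarrow> R x z" and refl: "\<And>x. R x (x :: real)"
    and step: "\<And>i j. \<lbrakk>next_in I i j; P i; Q j\<rbrakk> \<Longrightarrow> R (u i) (u j)"
    and P: "\<And>i j. \<lbrakk>P i; i \<le> j\<rbrakk> \<Longrightarrow> P j" and Q: "\<And>i j. \<lbrakk>Q j; i \<le> j\<rbrakk> \<Longrightarrow> Q i"
    and "i \<in> I" "j \<in> I" "i \<le> j" "P i" "Q j"
  shows "R (u i) (u j)"
  using assms(6-)
proof (induction "j - i" arbitrary: i rule: less_induct)
  case less
  show ?case
  proof (cases "i = j")
    case True
    then show ?thesis using refl by simp
  next
    case False
    define k where "k = (LEAST k. k \<in> I \<and> i < k)"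
    have ex: "j \<in> I \<and> i < j" using False less.prems by simp
    have k: "k \<in> I" "i < k" "k \<le> j"
      using LeastI[of "\<lambda>k. k \<in> I \<and> i < k", OF ex] Least_le[of "\<lambda>k. k \<in> I \<and> i < k", OF ex]
      by (auto simp: k_def)
    have "next_in I i k"
      unfolding next_in_def using k less.prems not_less_Least[of _ "\<lambda>k. k \<in> I \<and> i < k"]
      by (auto simp: k_def)
    then have "R (u i) (u k)" using step less.prems Q k by blast
    moreover have "R (u k) (u j)"
      by (rule less.hyps) (use k less.prems P[of i k] in auto)
    ultimately show ?thesis by (rule trans)
  qed
qed

definition peak_at :: "nat set \<Rightarrow> (nat \<Rightarrow> real) \<Rightarrow> nat \<Rightarrow> bool" where
  "peak_at I u a \<longleftrightarrow> a \<in> I \<and>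
     (\<forall>i\<in>I. \<forall>j\<in>I. i \<le> j \<longrightarrow> (j \<le> a \<longrightarrow> u i \<le> u j) \<and> (a \<le> i \<longrightarrow> u j \<le> u i))"

lemma peak_atD:
  assumes "peak_at I u a"
  shows "a \<in> I" "\<And>i j. \<lbrakk>i \<in> I; j \<in> I; i \<le> j; j \<le> a\<rbrakk> \<Longrightarrow> u i \<le> u j"
    "\<And>i j. \<lbrakk>i \<in> I; j \<in> I; a \<le> i; i \<le> j\<rbrakk> \<Longrightarrow> u j \<le> u i"
  using assms by (simp_all add: peak_at_def)

lemma peak_at_max:
  assumes "peak_at I u a" "j \<in> I"
  shows "u j \<le> u a"
  using peak_atD(1)[OF assms(1)] peak_atD(2)[OF assms(1), of j a] peak_atD(3)[OF assms(1), of a j]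
    assms(2) by (cases "j \<le> a") simp_all

lemma unimodal_imp_peak:
  assumes "unimodal I u" "I \<noteq> {}"
  shows "\<exists>a. peak_at I u a"
proof (cases "constant_seq I u")
  case True
  then obtain c where "\<forall>j\<in>I. u j = c" unfolding constant_seq_def by blast
  moreover obtain a where "a \<in> I" using assms(2) by blast
  ultimately show ?thesis by (intro exI[of _ a]) (simp add: peak_at_def)
next
  case False
  then obtain a b where "a \<in> I"
      and up: "\<forall>i j. next_in I i j \<and> i < a \<longrightarrow> u i \<le> u j"
      and eq: "\<forall>i j. next_in I i j \<and> a \<le> i \<and> i < b \<longrightarrow> u i = u j"
      and down: "\<forall>i j. next_in I i j \<and> b \<le> i \<longrightarrow> u i \<ge> u j"
    using assms(1) unfolding unimodal_def by auto
  have up': "u i \<le> u j" if "next_in I i j" "True" "j \<le> a" for i j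
    using up that by (simp add: next_in_def)
  have down': "u j \<le> u i" if "next_in I i j" "a \<le> i" "True" for i j
    using eq[rule_format, of i j] down[rule_format, of i j] that by (cases "i < b") auto
  have "u i \<le> u j" if ij: "i \<in> I" "j \<in> I" "i \<le> j" "j \<le> a" for i j
    by (rule next_in_chain[of "(\<le>)" I "\<lambda>_. True" "\<lambda>j. j \<le> a" u, OF _ _ up' _ _ ij(1-3) TrueI ij(4)])
      simp_all
  moreover have "u j \<le> u i" if ij: "i \<in> I" "j \<in> I" "a \<le> i" "i \<le> j" for i j
    by (rule next_in_chain[of "(\<ge>)" I "\<lambda>j. a \<le> j" "\<lambda>_. True" u, OF _ _ down' _ _ ij(1,2,4,3) TrueI])
      simp_all
  ultimately show ?thesis
    using \<open>a \<in> I\<close> unfolding peak_at_def by blast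
qed

lemma peak_imp_unimodal:
  assumes peak: "peak_at I u a"
  shows "unimodal I u"
proof (cases "constant_seq I u")
  case True
  then show ?thesis by (simp add: unimodal_def)
next
  case False
  note a = peak_atD(1)[OF peak] and up = peak_atD(2)[OF peak] and down = peak_atD(3)[OF peak]
  obtain j where "j \<in> I" "u j \<noteq> u a" using False unfolding constant_seq_def by blast
  then have "\<exists>j\<in>I. ereal (u j) < ereal (u a)"
    using peak_at_max[OF peak, of j] by (intro bexI[of _ j]) simp_all
  then have "(INF j\<in>I. ereal (u j)) < ereal (u a)"
    by (simp only: INF_less_iff)
  moreover have "u i \<le> u j" if ij: "next_in I i j" "i < a" for i j
  proof -
    have "a \<notin> {i<..<j}" using ij(1) a by (auto simp: next_in_def)
    then have "j \<le> a" using ij(2) by simp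
    then show ?thesis using up[of i j] ij(1) by (simp add: next_in_def)
  qed
  moreover have "u j \<le> u i" if "next_in I i j" "a \<le> i" for i j
    using down[of i j] that by (simp add: next_in_def)
  ultimately have "\<exists>a\<in>I. \<exists>b\<in>I. a \<le> b \<and>
        (\<forall>i j. next_in I i j \<and> i < a \<longrightarrow> u i \<le> u j) \<and>
        (\<forall>i j. next_in I i j \<and> a \<le> i \<and> i < b \<longrightarrow> u i = u j) \<and>
        (\<forall>i j. next_in I i j \<and> b \<le> i \<longrightarrow> u i \<ge> u j) \<and>
        ereal (u a) > (INF j\<in>I. ereal (u j))"
    using a by (intro bexI[of _ a] conjI allI impI) simp_all
  then show ?thesis unfolding unimodal_def by blast
qed

lemma unimodal_between:
  assumes "unimodal I u" "l \<in> I" "m \<in> I" "n \<in> I" "l \<le> m" "m \<le> n"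
  shows "min (u l) (u n) \<le> u m"
proof -
  have "I \<noteq> {}" using assms(2) by blast
  then obtain a where peak: "peak_at I u a" using unimodal_imp_peak[OF assms(1)] by blast
  have "u l \<le> u m \<or> u n \<le> u m"
    using peak_atD(2)[OF peak assms(2,3,5)] peak_atD(3)[OF peak assms(3,4) _ assms(6)]
    by (cases "m \<le> a") simp_all
  then show ?thesis by auto
qed

text \<open>For \<open>i < j < a\<close> the minimum of \<open>u i\<close> and the maximal value
  \<open>u a\<close> is \<open>u i\<close>, so the absence of dips means growth up to
  \<open>a\<close>; symmetrically beyond \<open>a\<close>.\<close>

lemma unimodal_if_between:
  assumes a: "a \<in> I" and max: "\<And>j. j \<in> I \<Longrightarrow> u j \<le> u a"
    and between: "\<And>l m n. \<lbrakk>l \<in> I; m \<in> I; n \<in> I; l < m; m < n\<rbrakk> \<Longrightarrow> min (u l) (u n) \<le> u m"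
  shows "unimodal I u"
proof -
  have "u i \<le> u j" if "i \<in> I" "j \<in> I" "i \<le> j" "j \<le> a" for i j
    using between[of i j a] max[of i] max[of j] that a
    by (cases "i = j \<or> j = a") auto
  moreover have "u j \<le> u i" if "i \<in> I" "j \<in> I" "a \<le> i" "i \<le> j" for i j
    using between[of a i j] max[of i] max[of j] that a
    by (cases "i = j \<or> i = a") auto
  ultimately have "peak_at I u a"
    unfolding peak_at_def using a by blast
  then show ?thesis by (rule peak_imp_unimodal)
qed

text \<open>Beyond the peaks of \<open>u\<close> and of its negative, \<open>u\<close> is both
  nonincreasing and nondecreasing.\<close>

lemma unimodal_uminus_eventually_const:
  assumes "unimodal I u" "unimodal I (\<lambda>n. - u n)" "I \<noteq> {}"
  obtains N where "N \<in> I" "\<And>n. \<lbrakk>n \<in> I; N \<le> n\<rbrakk> \<Longrightarrow> u n = u N"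
proof -
  obtain a b where a: "peak_at I u a" and b: "peak_at I (\<lambda>n. - u n) b"
    using unimodal_imp_peak assms by blast
  have N: "max a b \<in> I" using peak_atD(1)[OF a] peak_atD(1)[OF b] by (simp add: max_def)
  show thesis
  proof (rule that[OF N])
    fix n assume "n \<in> I" "max a b \<le> n"
    then show "u n = u (max a b)"
      using peak_atD(3)[OF a N, of n] peak_atD(3)[OF b N, of n] by simp
  qed
qed

lemma unimodal_cong:
  assumes "unimodal I u" and eq: "\<And>j. j \<in> I \<Longrightarrow> u j = w j"
  shows "unimodal I w"
proof (cases "I = {}")
  case True
  then show ?thesis by (simp add: unimodal_def constant_seq_def)
next
  case False
  then obtain a where "peak_at I u a" using unimodal_imp_peak[OF assms(1)] by blast
  then have "peak_at I w a" by (simp add: peak_at_def eq)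
  then show ?thesis by (rule peak_imp_unimodal)
qed

section \<open>Convergence and linearity of the transformation\<close>

lemma transf_defined_summable:
  assumes "transf_defined I K f" "n \<in> I"
  shows "summable (\<lambda>j. if j \<in> I then K n j * f j else 0)"
proof -
  obtain l where "uniform_limit I (\<lambda>N n. \<Sum>j<N. if j \<in> I then K n j * f j else 0) l sequentially"
    using assms(1) unfolding transf_defined_def uniformly_convergent_on_def by blast
  from tendsto_uniform_limitI[OF this assms(2)] show ?thesis
    by (auto simp: summable_iff_convergent convergent_def)
qed

lemma transf_sums:
  assumes "transf_defined I K f" "n \<in> I"
  shows "(\<lambda>j. if j \<in> I then K n j * f j else 0) sums transf I K f n"
  unfolding transf_def by (rule summable_sums[OF transf_defined_summable[OF assms]])

lemma transf_linear:
  assumes "transf_defined I K f" "transf_defined I K g" "n \<in> I"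
  shows "transf I K (\<lambda>j. a * f j + b * g j) n = a * transf I K f n + b * transf I K g n"
proof -
  have "(\<lambda>j. a * (if j \<in> I then K n j * f j else 0) + b * (if j \<in> I then K n j * g j else 0))
      sums (a * transf I K f n + b * transf I K g n)"
    by (intro sums_add sums_mult transf_sums assms)
  also have "(\<lambda>j. a * (if j \<in> I then K n j * f j else 0) + b * (if j \<in> I then K n j * g j else 0))
      = (\<lambda>j. if j \<in> I then K n j * (a * f j + b * g j) else 0)"
    by (rule ext) (simp add: algebra_simps)
  finally show ?thesis
    unfolding transf_def by (rule sums_unique[symmetric])
qed

lemma transf_defined_linear:
  assumes "transf_defined I K f" "transf_defined I K g"
  shows "transf_defined I K (\<lambda>j. a * f j + b * g j)"
proof -
  have "uniformly_convergent_on I (\<lambda>N n. a * (\<Sum>j<N. if j \<in> I then K n j * f j else 0)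
      + b * (\<Sum>j<N. if j \<in> I then K n j * g j else 0))"
    using assms unfolding transf_defined_def
    by (intro uniformly_convergent_add uniformly_convergent_mult)
  also have "(\<lambda>N n. a * (\<Sum>j<N. if j \<in> I then K n j * f j else 0)
      + b * (\<Sum>j<N. if j \<in> I then K n j * g j else 0))
      = (\<lambda>N n. \<Sum>j<N. if j \<in> I then K n j * (a * f j + b * g j) else 0)"
    by (intro ext) (simp add: sum_distrib_left sum.distrib[symmetric] algebra_simps
        if_distrib[where f = "\<lambda>x. _ * x"] cong: if_cong, intro sum.cong, simp_all)
  finally show ?thesis
    unfolding transf_defined_def .
qed

text \<open>For a nonnegative kernel each block of the series for \<open>f\<close> is bounded by
  \<open>C\<close> times the same block for \<open>g\<close>, in every row, so the uniform Cauchy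
  property carries over.\<close>

lemma transf_defined_dominated:
  assumes pos: "\<And>n j. \<lbrakk>n \<in> I; j \<in> I\<rbrakk> \<Longrightarrow> 0 \<le> K n j"
    and g: "transf_defined I K g"
    and f: "\<And>j. j \<in> I \<Longrightarrow> \<bar>f j\<bar> \<le> C * g j"
  shows "transf_defined I K f"
  unfolding transf_defined_def
proof (rule Cauchy_uniformly_convergent, rule uniformly_Cauchy_onI')
  fix e :: real assume "e > 0"
  let ?F = "\<lambda>N n. \<Sum>j<N. if j \<in> I then K n j * f j else 0"
  let ?G = "\<lambda>N n. \<Sum>j<N. if j \<in> I then K n j * g j else 0"
  \<comment> \<open>The added 1 covers \<open>C = 0\<close>.\<close>
  define d where "d = e / (\<bar>C\<bar> + 1)"
  have "d > 0" using \<open>e > 0\<close> by (simp add: d_def)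
  with uniformly_convergent_Cauchy[OF g[unfolded transf_defined_def]]
  obtain M where M: "\<forall>x\<in>I. \<forall>m\<ge>M. \<forall>n\<ge>M. dist (?G m x) (?G n x) < d"
    unfolding uniformly_Cauchy_on_def by blast
  have "dist (?F m x) (?F n x) < e" if x: "x \<in> I" and mn: "M \<le> m" "m < n" for x m n
  proof -
    have diff: "(\<Sum>j<m. h j) - (\<Sum>j<n. h j) = - (\<Sum>j=m..<n. h j)" for h :: "nat \<Rightarrow> real"
      using sum.atLeastLessThan_concat[of 0 m n h] mn by (simp add: atLeast0LessThan)
    have "dist (?F m x) (?F n x) = \<bar>\<Sum>j=m..<n. if j \<in> I then K x j * f j else 0\<bar>"
      by (simp add: dist_real_def diff)
    also have "\<dots> \<le> (\<Sum>j=m..<n. C * (if j \<in> I then K x j * g j else 0))"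
    proof (rule order_trans[OF sum_abs sum_mono])
      fix j
      show "\<bar>if j \<in> I then K x j * f j else 0\<bar> \<le> C * (if j \<in> I then K x j * g j else 0)"
        using mult_left_mono[OF f pos[OF x], of j j] pos[OF x, of j]
        by (simp add: abs_mult mult.left_commute)
    qed
    also have "\<dots> = C * (\<Sum>j=m..<n. if j \<in> I then K x j * g j else 0)"
      by (simp add: sum_distrib_left)
    also have "\<dots> \<le> \<bar>C\<bar> * dist (?G m x) (?G n x)"
      by (simp add: dist_real_def diff abs_mult[symmetric] del: abs_mult)
    also have "\<dots> \<le> (\<bar>C\<bar> + 1) * dist (?G m x) (?G n x)"
      by (intro mult_right_mono) simp_all
    also have "\<dots> < (\<bar>C\<bar> + 1) * d"
    proof (rule mult_strict_left_mono)
      show "dist (?G m x) (?G n x) < d" using M x mn by simp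
    qed simp
    also have "\<dots> = e" by (simp add: d_def)
    finally show ?thesis .
  qed
  then show "\<exists>M. \<forall>x\<in>I. \<forall>m\<ge>M. \<forall>n>m. dist (?F m x) (?F n x) < e" by blast
qed

lemma transf_ge_term:
  assumes pos: "\<And>n j. \<lbrakk>n \<in> I; j \<in> I\<rbrakk> \<Longrightarrow> 0 < K n j"
    and f: "transf_defined I K f" "\<And>j. j \<in> I \<Longrightarrow> 0 \<le> f j"
    and j: "j \<in> I" and n: "n \<in> I"
  shows "K n j * f j \<le> transf I K f n"
proof -
  have "f j * (1 * K n j + 0 * K n j + 0 * K n j)
      \<le> 1 * transf I K f n + 0 * transf I K f n + 0 * transf I K f n"
  proof (rule transf_linear_form_ge[OF _ _ j])
    fix i assume "i \<in> I"
    then show "0 \<le> f i * (1 * K n i + 0 * K n i + 0 * K n i)"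
      using f(2)[of i] pos[OF n, of i] by simp
  qed (use transf_defined_summable[OF f(1) n] in auto)
  then show ?thesis by (simp add: mult.commute)
qed

lemma det3_eq_cols [simp]: "det3 a a c l m n = 0" "det3 a b b l m n = 0"
  by (simp_all add: det3_def det2_def algebra_simps)

section \<open>Positive kernels that preserve or reverse unimodality\<close>

text \<open>The assumption \<open>ones\<close> gives every bounded sequence a transform, in
  particular the step functions used as tests.\<close>

locale unimodal_kernel =
  fixes I :: "nat set" and K :: "nat \<Rightarrow> nat \<Rightarrow> real" and s :: real
  assumes pos: "\<lbrakk>n \<in> I; j \<in> I\<rbrakk> \<Longrightarrow> 0 < K n j"
    and sign: "s \<in> {-1, 1}"
    and ones: "transf_defined I K (\<lambda>_. 1)"
    and preserving: "\<lbrakk>unimodal I f; transf_defined I K f\<rbrakk> \<Longrightarrow> unimodal I (\<lambda>n. s * transf I K f n)"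
    and SR3: "SR3 I K"
begin

lemma nonneg: "\<lbrakk>n \<in> I; j \<in> I\<rbrakk> \<Longrightarrow> 0 \<le> K n j"
  using pos by (simp add: less_imp_le)

lemma bounded_defined:
  assumes "\<And>j. j \<in> I \<Longrightarrow> \<bar>f j\<bar> \<le> C"
  shows "transf_defined I K f"
  by (rule transf_defined_dominated[OF nonneg ones, of f C]) (use assms in auto)

text \<open>
  Were a 3-minor to have the wrong sign, its columns could be enlarged to sums \<open>A\<close>, \<open>B\<close>, \<open>C\<close> over
  three consecutive blocks of indices. Cramer's rule for the columns \<open>A\<close>, \<open>A + B + C\<close>, \<open>C\<close> gives a
  step function \<open>\<phi>\<close> for which \<open>s L \<phi>\<close> has signs \<open>(+,-,+)\<close> on the three rows, while the signs of
  the 2-minors make \<open>\<phi>\<close> unimodal.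
\<close>

lemma minor_signs:
  obtains e :: real where "e \<in> {-1, 1}"
    "\<And>l m i j. \<lbrakk>l \<in> I; m \<in> I; i \<in> I; j \<in> I; l < m; i < j\<rbrakk>
       \<Longrightarrow> 0 \<le> e * det2 (\<lambda>n. K n i) (\<lambda>n. K n j) l m"
    "\<And>l m n i j k. \<lbrakk>l \<in> I; m \<in> I; n \<in> I; i \<in> I; j \<in> I; k \<in> I; l < m; m < n; i < j; j < k\<rbrakk>
       \<Longrightarrow> 0 \<le> (s * e) * det3 (\<lambda>n. K n i) (\<lambda>n. K n j) (\<lambda>n. K n k) l m n"
proof -
  obtain e2 e3 :: real where e2: "e2 \<in> {-1, 1}" and e3: "e3 \<in> {-1, 1}"
    and minors2: "\<And>l m i j. \<lbrakk>l \<in> I; m \<in> I; i \<in> I; j \<in> I; l < m; i < j\<rbrakk>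
       \<Longrightarrow> 0 \<le> e2 * det2 (\<lambda>n. K n i) (\<lambda>n. K n j) l m"
    and minors3: "\<And>l m n i j k. \<lbrakk>l \<in> I; m \<in> I; n \<in> I; i \<in> I; j \<in> I; k \<in> I; l < m; m < n; i < j; j < k\<rbrakk>
       \<Longrightarrow> 0 \<le> e3 * det3 (\<lambda>n. K n i) (\<lambda>n. K n j) (\<lambda>n. K n k) l m n"
    by (rule SR3_minors[OF SR3]) (rule that)
  have "0 \<le> (s * e2) * det3 (\<lambda>n. K n i) (\<lambda>n. K n j) (\<lambda>n. K n k) l m n"
    if rows: "l \<in> I" "m \<in> I" "n \<in> I" "l < m" "m < n"
      and cols: "i \<in> I" "j \<in> I" "k \<in> I" "i < j" "j < k" for l m n i j k
  proof (rule ccontr)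
    let ?D = "det3 (\<lambda>n. K n i) (\<lambda>n. K n j) (\<lambda>n. K n k) l m n"
    assume neg: "\<not> 0 \<le> (s * e2) * ?D"
    have "0 \<le> e3 * ?D" using minors3 rows cols by simp
    with neg sign e2 e3 have e3_eq: "e3 = - (s * e2)" and D: "0 < e3 * ?D"
      by auto
    define fA :: "nat \<Rightarrow> real" where "fA p = (if p < j then 1 else 0)" for p
    define fB :: "nat \<Rightarrow> real" where "fB p = (if j \<le> p \<and> p < k then 1 else 0)" for p
    define fC :: "nat \<Rightarrow> real" where "fC p = (if k \<le> p then 1 else 0)" for p
    define A where "A = transf I K fA"
    define B where "B = transf I K fB"
    define C where "C = transf I K fC"
    \<comment> \<open>On \<open>I\<close> this is the transform of the constant 1. A multiple of it
      shifts the step function by a constant, so its coefficient may have either sign.\<close>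
    define H where "H n = A n + B n + C n" for n
    have dA: "transf_defined I K fA" and dB: "transf_defined I K fB" and dC: "transf_defined I K fC"
      by (rule bounded_defined[of _ 1]; simp add: fA_def fB_def fC_def)+
    have "0 < e3 * det3 A B C l m n"
    proof -
      \<comment> \<open>The three indicators equal 1 at the columns of the offending minor, so its
        strict sign survives.\<close>
      have "fA i * fB j * fC k * (e3 * ?D) \<le> e3 * det3 A B C l m n"
        unfolding A_def B_def C_def
      proof (rule det3_transf_ge)
        fix i j k assume "i \<in> I" "j \<in> I" "k \<in> I" "i < j" "j < k"
        then show "0 \<le> e3 * det3 (\<lambda>n. K n i) (\<lambda>n. K n j) (\<lambda>n. K n k) l m n"
          by (intro minors3 rows)
      qed (use rows cols dA dB dC in
          \<open>auto simp: fA_def fB_def fC_def intro: transf_defined_summable split: if_splits\<close>)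
      then show ?thesis using D cols by (simp add: fA_def fB_def fC_def)
    qed
    moreover have "det3 A H C l m n = det3 A B C l m n"
      by (simp add: H_def det3_def det2_def algebra_simps)
    ultimately have Delta: "0 < e3 * det3 A H C l m n" by simp
    have AC: "0 \<le> e2 * det2 A C l' m'" and HC: "0 \<le> e2 * det2 H C l' m'"
      and AH: "0 \<le> e2 * det2 A H l' m'"
      if "l' \<in> I" "m' \<in> I" "l' < m'" for l' m'
    proof -
      have m2: "0 \<le> e2 * det2 (\<lambda>n. K n i) (\<lambda>n. K n j) l' m'" if "i \<in> I" "j \<in> I" "i < j" for i j
        by (intro minors2 that \<open>l' \<in> I\<close> \<open>m' \<in> I\<close> \<open>l' < m'\<close>)
      note det2 = det2_transf_nonneg[OF m2 that(1,2)]
      have summ: "summable (\<lambda>p. if p \<in> I then K i p * f p else 0)"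
        if "transf_defined I K f" "i \<in> {l', m'}" for f i
        using that \<open>l' \<in> I\<close> \<open>m' \<in> I\<close> by (auto intro: transf_defined_summable)
      show 1: "0 \<le> e2 * det2 A C l' m'"
        unfolding A_def C_def
        by (rule det2; (rule summ[OF dA] | rule summ[OF dC] | use cols in \<open>simp add: fA_def fC_def split: if_splits\<close>))
      have 2: "0 \<le> e2 * det2 A B l' m'"
        unfolding A_def B_def
        by (rule det2; (rule summ[OF dA] | rule summ[OF dB] | use cols in \<open>simp add: fA_def fB_def split: if_splits\<close>))
      have 3: "0 \<le> e2 * det2 B C l' m'"
        unfolding B_def C_def
        by (rule det2; (rule summ[OF dB] | rule summ[OF dC] | use cols in \<open>simp add: fB_def fC_def split: if_splits\<close>))
      show "0 \<le> e2 * det2 H C l' m'"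
        using 1 3 by (simp add: H_def det2_def algebra_simps)
      show "0 \<le> e2 * det2 A H l' m'"
        using 1 2 by (simp add: H_def det2_def algebra_simps)
    qed
    \<comment> \<open>Cramer's rule: with d = \<open>e2 * det3 A H C l m n\<close>, the combination
      \<open>\<alpha> * A + \<gamma> * H + \<beta> * C\<close> takes the values d, -d, d at
      \<open>l\<close>, \<open>m\<close>, \<open>n\<close>.\<close>
    define \<alpha> where "\<alpha> = e2 * det2 H C m n + e2 * det2 H C l n + e2 * det2 H C l m"
    define \<beta> where "\<beta> = e2 * det2 A H m n + e2 * det2 A H l n + e2 * det2 A H l m"
    define \<gamma> where "\<gamma> = - (e2 * det2 A C m n + e2 * det2 A C l n + e2 * det2 A C l m)"
    \<comment> \<open>The block values are \<open>- (\<alpha> + \<gamma>)\<close>,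
      \<open>- \<gamma>\<close>, \<open>- (\<beta> + \<gamma>)\<close>; as \<open>\<alpha>\<close>
      and \<open>\<beta>\<close> are nonnegative, the middle block is the highest.\<close>
    define \<phi> where "\<phi> p = (-1) * ((\<alpha> + \<gamma>) * fA p + \<gamma> * fB p) + (- (\<beta> + \<gamma>)) * fC p" for p
    have "l < n" using rows by simp
    have \<alpha>: "0 \<le> \<alpha>" and \<beta>: "0 \<le> \<beta>"
      unfolding \<alpha>_def \<beta>_def by (intro add_nonneg_nonneg HC AH rows \<open>l < n\<close>)+
    have "peak_at I \<phi> j"
      using cols \<alpha> \<beta> by (auto simp: peak_at_def \<phi>_def fA_def fB_def fC_def)
    then have uni: "unimodal I \<phi>" by (rule peak_imp_unimodal)
    have d\<phi>: "transf_defined I K \<phi>"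
      unfolding \<phi>_def by (intro transf_defined_linear dA dB dC)
    have L: "transf I K \<phi> p = - (\<alpha> * A p + \<gamma> * H p + \<beta> * C p)" if "p \<in> I" for p
      unfolding \<phi>_def transf_linear[OF transf_defined_linear[OF dA dB] dC that]
        transf_linear[OF dA dB that]
      by (simp add: A_def B_def C_def H_def algebra_simps)
    have Ll: "transf I K \<phi> l = - (e2 * det3 A H C l m n)"
      unfolding L[OF rows(1)] \<alpha>_def \<beta>_def \<gamma>_def det3_def det2_def by (simp add: algebra_simps)
    have Lm: "transf I K \<phi> m = e2 * det3 A H C l m n"
      unfolding L[OF rows(2)] \<alpha>_def \<beta>_def \<gamma>_def det3_def det2_def by (simp add: algebra_simps)
    have Ln: "transf I K \<phi> n = - (e2 * det3 A H C l m n)"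
      unfolding L[OF rows(3)] \<alpha>_def \<beta>_def \<gamma>_def det3_def det2_def by (simp add: algebra_simps)
    have "min (s * transf I K \<phi> l) (s * transf I K \<phi> n) \<le> s * transf I K \<phi> m"
      using rows by (intro unimodal_between[OF preserving[OF uni d\<phi>]]) simp_all
    then show False
      using Delta unfolding Ll Lm Ln e3_eq by simp
  qed
  with that[OF e2 minors2] show thesis by blast
qed

text \<open>With \<open>A\<close>, \<open>B\<close>, \<open>C\<close> the three transforms, expand
  the determinant of the columns \<open>y\<close>, \<open>B\<close>, \<open>C\<close> along
  \<open>y\<close>. The assumed signs make every summand nonnegative once scaled by
  \<open>s * e\<close>, while the total is \<open>- (s * e) * det3 A B C l m n\<close>, which is at
  most 0; hence all summands vanish. The columns \<open>y\<close>, \<open>A\<close>,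
  \<open>B\<close> behave alike. What remains is the degenerate case, in which \<open>B\<close>
  vanishes at \<open>l\<close> and \<open>m\<close>.\<close>

lemma variation_diminishing:
  assumes f1: "\<And>j. j \<in> I \<Longrightarrow> 0 \<le> f1 j" and f2: "\<And>j. j \<in> I \<Longrightarrow> 0 \<le> f2 j"
    and f3: "\<And>j. j \<in> I \<Longrightarrow> 0 \<le> f3 j"
    and f12: "\<And>i j. \<lbrakk>i \<in> I; j \<in> I; f1 i > 0; f2 j > 0\<rbrakk> \<Longrightarrow> i < j"
    and f23: "\<And>i j. \<lbrakk>i \<in> I; j \<in> I; f2 i > 0; f3 j > 0\<rbrakk> \<Longrightarrow> i < j"
    and d1: "transf_defined I K f1" and d2: "transf_defined I K f2" and d3: "transf_defined I K f3"
    and y: "\<And>n. n \<in> I \<Longrightarrow> y n = transf I K f2 n - transf I K f1 n - transf I K f3 n"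
    and rows: "l \<in> I" "m \<in> I" "n \<in> I" "l < m" "m < n"
    and signs: "0 < s * y l" "s * y m < 0" "0 < s * y n"
  shows False
proof -
  obtain e :: real where e: "e \<in> {-1, 1}"
    and minors2: "\<And>l m i j. \<lbrakk>l \<in> I; m \<in> I; i \<in> I; j \<in> I; l < m; i < j\<rbrakk>
       \<Longrightarrow> 0 \<le> e * det2 (\<lambda>n. K n i) (\<lambda>n. K n j) l m"
    and minors3: "\<And>l m n i j k. \<lbrakk>l \<in> I; m \<in> I; n \<in> I; i \<in> I; j \<in> I; k \<in> I; l < m; m < n; i < j; j < k\<rbrakk>
       \<Longrightarrow> 0 \<le> (s * e) * det3 (\<lambda>n. K n i) (\<lambda>n. K n j) (\<lambda>n. K n k) l m n"
    by (rule minor_signs) (rule that)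
  define A where "A = transf I K f1"
  define B where "B = transf I K f2"
  define C where "C = transf I K f3"
  have yB: "y p = B p - A p - C p" if "p \<in> I" for p
    using y[OF that] by (simp add: A_def B_def C_def)
  \<comment> \<open>Only nonnegativity is wanted, so the retained term is taken with three equal
    columns, which makes it 0.\<close>
  have "f1 l * f2 l * f3 l * ((s * e) * det3 (\<lambda>n. K n l) (\<lambda>n. K n l) (\<lambda>n. K n l) l m n)
      \<le> (s * e) * det3 A B C l m n"
    unfolding A_def B_def C_def
    by (rule det3_transf_ge[OF minors3 f1 f2 f3 f12 f23])
      (use rows d1 d2 d3 in \<open>auto intro: transf_defined_summable\<close>)
  then have ABC: "0 \<le> (s * e) * det3 A B C l m n" by simp
  have AB: "0 \<le> e * det2 A B l' m'" and BC: "0 \<le> e * det2 B C l' m'"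
    if "l' \<in> I" "m' \<in> I" "l' < m'" for l' m'
  proof -
    have m2: "0 \<le> e * det2 (\<lambda>n. K n i) (\<lambda>n. K n j) l' m'" if "i \<in> I" "j \<in> I" "i < j" for i j
      by (intro minors2 that \<open>l' \<in> I\<close> \<open>m' \<in> I\<close> \<open>l' < m'\<close>)
    have summ: "summable (\<lambda>p. if p \<in> I then K i p * f p else 0)"
      if "transf_defined I K f" "i \<in> {l', m'}" for f i
      using that \<open>l' \<in> I\<close> \<open>m' \<in> I\<close> by (auto intro: transf_defined_summable)
    show "0 \<le> e * det2 A B l' m'" unfolding A_def B_def
      by (rule det2_transf_nonneg[OF m2 that(1,2) f1 f2 f12 summ[OF d1] summ[OF d2]])
    show "0 \<le> e * det2 B C l' m'" unfolding B_def C_def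
      by (rule det2_transf_nonneg[OF m2 that(1,2) f2 f3 f23 summ[OF d2] summ[OF d3]])
  qed
  have "l < n" using rows by simp
  have nn: "0 \<le> - (s * y m)" "0 \<le> s * y l" "0 \<le> s * y n" using signs by simp_all
  have "(s * y l) * (e * det2 B C m n) + (- (s * y m)) * (e * det2 B C l n)
      + (s * y n) * (e * det2 B C l m) = - ((s * e) * det3 A B C l m n)"
    unfolding yB[OF rows(1)] yB[OF rows(2)] yB[OF rows(3)] det3_def det2_def
    by (simp add: algebra_simps)
  moreover have "0 \<le> (s * y l) * (e * det2 B C m n)" "0 \<le> (- (s * y m)) * (e * det2 B C l n)"
    "0 \<le> (s * y n) * (e * det2 B C l m)"
    by (intro mult_nonneg_nonneg nn BC rows \<open>l < n\<close>)+
  ultimately have "(s * y n) * (e * det2 B C l m) = 0" using ABC by linarith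
  then have BC0: "det2 B C l m = 0" using e signs by auto
  have "(s * y l) * (e * det2 A B m n) + (- (s * y m)) * (e * det2 A B l n)
      + (s * y n) * (e * det2 A B l m) = - ((s * e) * det3 A B C l m n)"
    unfolding yB[OF rows(1)] yB[OF rows(2)] yB[OF rows(3)] det3_def det2_def
    by (simp add: algebra_simps)
  moreover have "0 \<le> (s * y l) * (e * det2 A B m n)" "0 \<le> (- (s * y m)) * (e * det2 A B l n)"
    "0 \<le> (s * y n) * (e * det2 A B l m)"
    by (intro mult_nonneg_nonneg nn AB rows \<open>l < n\<close>)+
  ultimately have "(s * y n) * (e * det2 A B l m) = 0" using ABC by linarith
  then have AB0: "det2 A B l m = 0" using e signs by auto
  \<comment> \<open>Both 2-minors on the right vanish. The two products on the left then agree
    although one is nonnegative and the other nonpositive, which forces \<open>B\<close> to be 0 at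
    \<open>l\<close> and \<open>m\<close>. Then \<open>y\<close> is nonpositive at both rows,
    against its opposite signs there.\<close>
  have "(s * y l) * B m - (s * y m) * B l = s * (det2 B C l m - det2 A B l m)"
    unfolding yB[OF rows(1)] yB[OF rows(2)] det2_def by (simp add: algebra_simps)
  then have yB_eq: "(s * y l) * B m = (s * y m) * B l"
    using BC0 AB0 by simp
  have ge: "0 \<le> transf I K f p" if "transf_defined I K f" "\<And>j. j \<in> I \<Longrightarrow> 0 \<le> f j" "p \<in> I" for f p
    using order_trans[OF mult_nonneg_nonneg[OF nonneg[OF that(3,3)] that(2)[OF that(3)]]
        transf_ge_term[OF pos that(1,2,3,3)]] .
  have "0 \<le> A l" "0 \<le> B l" "0 \<le> C l" "0 \<le> A m" "0 \<le> B m" "0 \<le> C m"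
    unfolding A_def B_def C_def by (intro ge d1 d2 d3 f1 f2 f3 rows; assumption)+
  moreover have "0 \<le> (s * y l) * B m" "(s * y m) * B l \<le> 0"
    using calculation signs by (simp_all add: mult_nonpos_nonneg)
  then have "B m = 0" "B l = 0" using yB_eq signs by auto
  ultimately have "y l \<le> 0" "y m \<le> 0" using yB rows by simp_all
  then show False using signs sign by auto
qed

text \<open>
  Both \<open>f\<close> and \<open>-f\<close> are unimodal for \<open>f = 1\<close> and for the indicator of the first index \<open>i\<close>, so the row
  sums and the entries of column \<open>i\<close> become constant. The 2-minors with column \<open>i\<close> then give
  all the differences of two late rows the same sign, while these differences sum to zero.
\<close>

lemma rows_eventually_const:
  assumes "I \<noteq> {}"
  obtains N where "N \<in> I" "\<And>n j. \<lbrakk>n \<in> I; j \<in> I; N \<le> n\<rbrakk> \<Longrightarrow> K n j = K N j"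
proof -
  obtain e :: real where e: "e \<in> {-1, 1}"
    and minors2: "\<And>l m i j. \<lbrakk>l \<in> I; m \<in> I; i \<in> I; j \<in> I; l < m; i < j\<rbrakk>
       \<Longrightarrow> 0 \<le> e * det2 (\<lambda>n. K n i) (\<lambda>n. K n j) l m"
    using minor_signs by metis
  \<comment> \<open>All other columns lie to the right of the first index, so the single sign
    \<open>e\<close> governs every 2-minor that involves it.\<close>
  define i where "i = (LEAST i. i \<in> I)"
  have i: "i \<in> I" and i_le: "\<And>j. j \<in> I \<Longrightarrow> i \<le> j"
    using assms LeastI_ex[of "\<lambda>i. i \<in> I"] Least_le[of "\<lambda>i. i \<in> I"] by (auto simp: i_def)
  \<comment> \<open>The negative of \<open>f\<close> is written as a linear combination to match
    \<open>transf_linear\<close> and \<open>transf_defined_linear\<close>.\<close>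
  have ev: "\<exists>N\<in>I. \<forall>n\<in>I. N \<le> n \<longrightarrow> transf I K f n = transf I K f N"
    if uni: "unimodal I f" "unimodal I (\<lambda>n. (-1) * f n + 0 * f n)" and d: "transf_defined I K f" for f
  proof -
    have "unimodal I (\<lambda>n. s * transf I K (\<lambda>j. (-1) * f j + 0 * f j) n)"
      by (rule preserving[OF uni(2) transf_defined_linear[OF d d]])
    then have neg: "unimodal I (\<lambda>n. - (s * transf I K f n))"
      by (rule unimodal_cong) (simp only: transf_linear[OF d d], simp)
    obtain N where N: "N \<in> I" "\<And>n. \<lbrakk>n \<in> I; N \<le> n\<rbrakk> \<Longrightarrow> s * transf I K f n = s * transf I K f N"
      by (rule unimodal_uminus_eventually_const[OF preserving[OF uni(1) d] neg assms]) (rule that)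
    have "s \<noteq> 0" using sign by auto
    then have "transf I K f n = transf I K f N" if "n \<in> I" "N \<le> n" for n
      using N(2)[OF that] by simp
    with N(1) show ?thesis by blast
  qed
  let ?\<delta> = "\<lambda>j. if j = i then 1 else (0::real)"
  have d: "transf_defined I K ?\<delta>" by (rule bounded_defined[of _ 1]) simp
  have "unimodal I (\<lambda>_. c)" for c :: real by (simp add: unimodal_def constant_seq_def)
  then obtain N1 where N1: "N1 \<in> I" "\<forall>n\<in>I. N1 \<le> n \<longrightarrow> transf I K (\<lambda>_. 1) n = transf I K (\<lambda>_. 1) N1"
    using ev[of "\<lambda>_. 1"] ones by auto
  have peak: "peak_at I ?\<delta> i"
    using i by (auto simp: peak_at_def dest: i_le)
  have "\<exists>k. peak_at I (\<lambda>n. (-1) * ?\<delta> n + 0 * ?\<delta> n) k"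
  \<comment> \<open>The negated indicator is -1 at \<open>i\<close> and 0 elsewhere, so any later
    index is a peak; without one, \<open>I\<close> is a singleton.\<close>
  proof (cases "\<exists>k\<in>I. i < k")
    case True
    then obtain k where "k \<in> I" "i < k" by blast
    then have "peak_at I (\<lambda>n. (-1) * ?\<delta> n + 0 * ?\<delta> n) k"
      by (auto simp: peak_at_def dest: i_le)
    then show ?thesis by blast
  next
    case False
    then have "peak_at I (\<lambda>n. (-1) * ?\<delta> n + 0 * ?\<delta> n) i"
      using i by (auto simp: peak_at_def dest: i_le)
    then show ?thesis by blast
  qed
  then have "unimodal I (\<lambda>n. (-1) * ?\<delta> n + 0 * ?\<delta> n)"
    using peak_imp_unimodal by blast
  from ev[OF peak_imp_unimodal[OF peak] this d]
  obtain N2 where N2: "N2 \<in> I" "\<forall>n\<in>I. N2 \<le> n \<longrightarrow> transf I K ?\<delta> n = transf I K ?\<delta> N2"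
    by blast
  have \<delta>: "transf I K ?\<delta> n = K n i" if "n \<in> I" for n
  proof -
    have "(\<lambda>j. if j = i then K n j else 0) sums K n i" by (rule sums_single)
    also have "(\<lambda>j. if j = i then K n j else 0) = (\<lambda>j. if j \<in> I then K n j * ?\<delta> j else 0)"
      using i by (intro ext) simp
    finally show ?thesis unfolding transf_def by (rule sums_unique[symmetric])
  qed
  define N where "N = max N1 N2"
  have N: "N \<in> I" using N1(1) N2(1) by (simp add: N_def max_def)
  have "K n j = K N j" if n: "n \<in> I" "N \<le> n" and j: "j \<in> I" for n j
  proof (cases "n = N")
    case False
    then have "N < n" using n by simp
    have Ki: "K n i = K N i" and h: "transf I K (\<lambda>_. 1) n = transf I K (\<lambda>_. 1) N"
      using N1(2) N2(2) n N \<delta>[OF n(1)] \<delta>[OF N] by (auto simp: N_def)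
    let ?g = "\<lambda>j. e * ((if j \<in> I then K n j * 1 else 0) - (if j \<in> I then K N j * 1 else 0))"
    have "?g sums (e * (transf I K (\<lambda>_. 1) n - transf I K (\<lambda>_. 1) N))"
      by (intro sums_mult sums_diff transf_sums ones n N)
    then have sums0: "?g sums 0" by (simp add: h)
    have nn: "0 \<le> ?g p" for p
    proof (cases "p \<in> I \<and> p \<noteq> i")
      case True
      then have "i < p" using i_le[of p] by simp
      then have "0 \<le> e * det2 (\<lambda>n. K n i) (\<lambda>n. K n p) N n"
        using True by (intro minors2 N n i \<open>N < n\<close>) simp_all
      then have "0 \<le> K N i * (e * (K n p - K N p))"
        by (simp add: det2_def Ki algebra_simps)
      then show ?thesis using pos[OF N i] True by (simp add: zero_le_mult_iff)
    qed (auto simp: Ki)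
    have "\<forall>p. ?g p = 0"
      using suminf_eq_zero_iff[OF sums_summable[OF sums0] nn] sums_unique[OF sums0] by simp
    then show ?thesis using e j by (auto dest!: spec[of _ j])
  qed simp
  with that[OF N] show thesis by blast
qed

text \<open>With \<open>r\<close> the old and \<open>x\<close> the new quotient, signs included,
  \<open>f = t * w - s * c * w1\<close> equals \<open>w1 * (r - s * c)\<close>, and \<open>s\<close>
  times its transform equals \<open>w2 * (x - c)\<close>. So level \<open>c\<close> of
  \<open>x\<close> corresponds to level \<open>s * c\<close> of \<open>r\<close>, and a dip of
  \<open>x\<close> below \<open>c\<close> would contradict \<open>variation_diminishing\<close>. The
  sign \<open>t\<close> is left free because it alternates under iteration when
  \<open>s = -1\<close>.\<close>

lemma quotient_step:
  assumes t: "t \<in> {-1, 1}"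
    and w: "\<And>j. j \<in> I \<Longrightarrow> 0 \<le> w j" "transf_defined I K w"
    and w1_def: "w1 = transf I K w" and w1: "\<And>j. j \<in> I \<Longrightarrow> 0 < w1 j" "transf_defined I K w1"
    and w2_def: "w2 = transf I K w1" and w2: "\<And>j. j \<in> I \<Longrightarrow> 0 < w2 j"
    and uni: "unimodal I (\<lambda>j. t * (w j / w1 j))" and "I \<noteq> {}"
  shows "unimodal I (\<lambda>j. s * t * (w1 j / w2 j))"
proof -
  define x where "x j = s * t * (w1 j / w2 j)" for j
  define r where "r j = t * (w j / w1 j)" for j
  obtain a where a: "peak_at I r a"
    using unimodal_imp_peak[OF uni \<open>I \<noteq> {}\<close>] unfolding r_def by blast
  have ss: "s * s = 1" and tt: "\<bar>t\<bar> = 1" "\<bar>s\<bar> = 1" using sign t by auto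
  have between: "min (x l) (x n) \<le> x m" if rows: "l \<in> I" "m \<in> I" "n \<in> I" "l < m" "m < n" for l m n
  proof (rule ccontr)
    assume "\<not> ?thesis"
    then have "x m < min (x l) (x n)" by (simp only: not_le)
    \<comment> \<open>A level strictly between the dip and both neighbours makes all three signs
      strict.\<close>
    from dense[OF this] obtain c where c: "x m < c" "c < x l" "c < x n" by auto
    define f where "f j = t * w j + (- (s * c)) * w1 j" for j
    \<comment> \<open>The split is \<open>f = f2 - f1 - f3\<close> on \<open>I\<close>: the negative
      parts up to and beyond the peak \<open>a\<close> of \<open>r\<close>, and between them the
      nonnegative part, which takes the zeros.\<close>
    define f1 where "f1 j = (if j \<le> a \<and> r j < s * c then - f j else 0)" for j
    define f2 where "f2 j = (if s * c \<le> r j then f j else 0)" for j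
    define f3 where "f3 j = (if a < j \<and> r j < s * c then - f j else 0)" for j
    have fr: "f j = w1 j * (r j - s * c)" if "j \<in> I" for j
      using w1(1)[OF that] by (simp add: f_def r_def field_simps)
    have f_le: "f j \<le> 0" if "j \<in> I" "r j < s * c" for j
      unfolding fr[OF that(1)] using w1(1)[OF that(1)] that(2) by (intro mult_nonneg_nonpos) simp_all
    have f_ge: "0 \<le> f j" if "j \<in> I" "s * c \<le> r j" for j
      unfolding fr[OF that(1)] using w1(1)[OF that(1)] that(2) by (intro mult_nonneg_nonneg) simp_all
    have dom: "transf_defined I K g" if "\<And>j. j \<in> I \<Longrightarrow> \<bar>g j\<bar> \<le> \<bar>f j\<bar>" for g
    proof (rule transf_defined_dominated[OF nonneg transf_defined_linear[OF w(2) w1(2), of 1 "\<bar>c\<bar>"], of g 1])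
      fix j assume j: "j \<in> I"
      have "\<bar>f j\<bar> \<le> \<bar>t * w j\<bar> + \<bar>(- (s * c)) * w1 j\<bar>"
        unfolding f_def by (rule abs_triangle_ineq)
      also have "\<dots> = w j + \<bar>c\<bar> * w1 j"
        using w(1)[OF j] w1(1)[OF j] tt by (simp add: abs_mult)
      finally show "\<bar>g j\<bar> \<le> 1 * (1 * w j + \<bar>c\<bar> * w1 j)" using that[OF j] by simp
    qed
    have d1: "transf_defined I K f1" and d2: "transf_defined I K f2" and d3: "transf_defined I K f3"
      by (rule dom; simp add: f1_def f2_def f3_def)+
    have f_split: "f = (\<lambda>j. 1 * (1 * f2 j + (-1) * f1 j) + (-1) * f3 j)"
      by (rule ext) (auto simp: f1_def f2_def f3_def)
    have Lf: "transf I K f p = transf I K f2 p - transf I K f1 p - transf I K f3 p" if "p \<in> I" for p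
      by (subst f_split)
        (simp only: transf_linear[OF transf_defined_linear[OF d2 d1] d3 that]
          transf_linear[OF d2 d1 that], simp)
    have sLf: "s * transf I K f p = w2 p * (x p - c)" if p: "p \<in> I" for p
    proof -
      have "transf I K f p = t * w1 p + (- (s * c)) * w2 p"
        unfolding f_def by (simp only: transf_linear[OF w(2) w1(2) p] w1_def[symmetric] w2_def[symmetric])
      then have "s * transf I K f p = s * (t * w1 p + (- (s * c)) * w2 p)" by (simp only:)
      also have "\<dots> = s * t * w1 p - (s * s) * c * w2 p" by (simp add: algebra_simps)
      also have "\<dots> = w2 p * (x p - c)" using w2[OF p] by (simp add: ss x_def field_simps)
      finally show ?thesis .
    qed
    show False
    proof (rule variation_diminishing[of f1 f2 f3 "transf I K f" l m n])
      fix i j assume ij: "i \<in> I" "j \<in> I" "0 < f1 i" "0 < f2 j"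
      then have "i \<le> a" "r i < s * c" "s * c \<le> r j"
        by (auto simp: f1_def f2_def split: if_splits)
      then show "i < j" using peak_atD(2)[OF a ij(2,1)] by (cases "j \<le> i") auto
    next
      fix i j assume ij: "i \<in> I" "j \<in> I" "0 < f2 i" "0 < f3 j"
      then have "a < j" "r j < s * c" "s * c \<le> r i"
        by (auto simp: f3_def f2_def split: if_splits)
      then show "i < j" using peak_atD(3)[OF a ij(2,1)] by (cases "j \<le> i") auto
    next
      show "0 < s * transf I K f l" "s * transf I K f m < 0" "0 < s * transf I K f n"
        using c w2 rows by (simp_all add: sLf mult_pos_neg)
    qed (use f_le f_ge rows Lf d1 d2 d3 in \<open>simp_all add: f1_def f2_def f3_def\<close>)
  qed
  obtain N where N: "N \<in> I" "\<And>n j. \<lbrakk>n \<in> I; j \<in> I; N \<le> n\<rbrakk> \<Longrightarrow> K n j = K N j"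
    by (rule rows_eventually_const[OF \<open>I \<noteq> {}\<close>]) (rule that)
  have "transf I K f n = transf I K f N" if "n \<in> I" "N \<le> n" for f n
    unfolding transf_def using N(2)[OF that(1) _ that(2)] by (intro suminf_cong) simp
  then have xN: "x n = x N" if "n \<in> I" "N \<le> n" for n
    unfolding x_def w1_def w2_def using that by simp
  \<comment> \<open>From \<open>N\<close> on \<open>x\<close> is constant, so its maximum is already
    attained on this finite set.\<close>
  define S where "S = {n \<in> I. n \<le> N}"
  have S: "finite (x ` S)" "x ` S \<noteq> {}" "N \<in> S" using N(1) by (auto simp: S_def)
  obtain b where b: "b \<in> S" "x b = Max (x ` S)" using Max_in[OF S(1,2)] by (metis imageE)
  have "x n \<le> x b" if "n \<in> I" for n
  proof (cases "n \<le> N")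
    case True
    then show ?thesis unfolding b(2) using that S(1) by (intro Max_ge) (auto simp: S_def)
  next
    case False
    then show ?thesis unfolding b(2) using xN[OF that] S by (auto intro!: Max_ge)
  qed
  moreover have "b \<in> I" using b(1) by (simp add: S_def)
  ultimately have "unimodal I x" using between by (intro unimodal_if_between)
  then show ?thesis by (simp add: x_def[abs_def])
qed

end

section \<open>Induction over the iterates\<close>

text \<open>By linearity, \<open>s\<close> times the transform of the signed difference at
  \<open>n\<close> is the one at \<open>n + 1\<close>.\<close>

lemma differences_unimodal:
  fixes I :: "nat set" and K :: "nat \<Rightarrow> nat \<Rightarrow> real"
  assumes defined: "\<And>n. transf_defined I K (iterate I K u n)"
    and preserving: "\<And>f. \<lbrakk>unimodal I f; transf_defined I K f\<rbrakk> \<Longrightarrow> unimodal I (\<lambda>n. s * transf I K f n)"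
    and uni: "unimodal I (\<lambda>j. u j - iterate I K u 1 j)"
  shows "unimodal I (\<lambda>j. s ^ n * (iterate I K u n j - iterate I K u (n + 1) j))"
proof (induction n)
  case 0
  then show ?case using uni by (simp add: iterate_def)
next
  case (Suc n)
  let ?v = "iterate I K u"
  let ?f = "\<lambda>j. s ^ n * ?v n j + (- (s ^ n)) * ?v (n + 1) j"
  have "unimodal I ?f"
    using Suc.IH by (simp add: right_diff_distrib)
  then have uni: "unimodal I (\<lambda>j. s * transf I K ?f j)"
    by (intro preserving transf_defined_linear defined)
  have v: "transf I K (?v m) = ?v (Suc m)" for m
    by (simp add: iterate_def)
  show ?case
  proof (rule unimodal_cong[OF uni])
    fix j assume "j \<in> I"
    then have "s * transf I K ?f j = s * (s ^ n * ?v (Suc n) j + (- (s ^ n)) * ?v (Suc (n + 1)) j)"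
      by (simp only: transf_linear[OF defined defined] v)
    also have "\<dots> = s ^ Suc n * (?v (Suc n) j - ?v (Suc n + 1) j)"
      by (simp add: algebra_simps)
    finally show "s * transf I K ?f j = s ^ Suc n * (?v (Suc n) j - ?v (Suc n + 1) j)" .
  qed
qed

lemma quotients_unimodal:
  fixes I :: "nat set" and K :: "nat \<Rightarrow> nat \<Rightarrow> real"
  assumes kernel: "admissible_kernel I K" and SR3: "SR3 I K" and s: "s \<in> {-1, 1}"
    and defined: "\<And>n. transf_defined I K (iterate I K u n)"
    and preserving: "\<And>f. \<lbrakk>unimodal I f; transf_defined I K f\<rbrakk> \<Longrightarrow> unimodal I (\<lambda>n. s * transf I K f n)"
    and nonconst: "\<not> constant_seq I u"
    and pos: "\<And>n j. \<lbrakk>n \<in> I; j \<in> I\<rbrakk> \<Longrightarrow> 0 < K n j"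
    and u: "\<And>j. j \<in> I \<Longrightarrow> 0 \<le> u j"
    and uni: "unimodal I (\<lambda>j. u j / iterate I K u 1 j)"
  shows "unimodal I (\<lambda>j. s ^ n * (iterate I K u n j / iterate I K u (n + 1) j))"
proof -
  let ?v = "iterate I K u"
  have v0: "?v 0 = u" and v: "?v (Suc m) = transf I K (?v m)" for m
    by (simp_all add: iterate_def)
  \<comment> \<open>One positive entry of \<open>u\<close> and a positive kernel make every later
    iterate strictly positive, so no quotient has a zero denominator.\<close>
  have "\<exists>j0\<in>I. u j0 \<noteq> 0" using nonconst unfolding constant_seq_def by blast
  then obtain j0 where j0: "j0 \<in> I" "0 < u j0" using u by (auto simp: less_le)
  then have "I \<noteq> {}" by blast
  have v_nonneg: "\<forall>j\<in>I. 0 \<le> ?v m j" and v_pos: "\<exists>j\<in>I. 0 < ?v m j"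
    and v_Suc_pos: "\<forall>j\<in>I. 0 < ?v (Suc m) j" for m
  proof -
    have step: "\<forall>j\<in>I. 0 < ?v (Suc m) j" if "\<forall>j\<in>I. 0 \<le> ?v m j" "\<exists>j\<in>I. 0 < ?v m j" for m
    proof
      fix n assume n: "n \<in> I"
      from that(2) obtain j where j: "j \<in> I" "0 < ?v m j" by blast
      have "0 < K n j * ?v m j" using pos[OF n j(1)] j(2) by simp
      also have "\<dots> \<le> ?v (Suc m) n"
        unfolding v using that(1) by (intro transf_ge_term[OF pos defined _ j(1) n]) simp_all
      finally show "0 < ?v (Suc m) n" .
    qed
    have "(\<forall>j\<in>I. 0 \<le> ?v m j) \<and> (\<exists>j\<in>I. 0 < ?v m j)" for m
    proof (induction m)
      case 0
      then show ?case using u j0 by (auto simp: v0)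
    next
      case (Suc m)
      then show ?case using step[of m] \<open>I \<noteq> {}\<close> by (auto simp: less_imp_le)
    qed
    then show "\<forall>j\<in>I. 0 \<le> ?v m j" "\<exists>j\<in>I. 0 < ?v m j" "\<forall>j\<in>I. 0 < ?v (Suc m) j"
      using step by blast+
  qed
  obtain q where q: "q \<in> I" "\<forall>n\<in>I. K q j0 \<le> K n j0"
    using kernel j0(1) unfolding admissible_kernel_def by blast
  define d where "d = K q j0 * u j0"
  have d: "0 < d" using pos[OF q(1) j0(1)] j0(2) by (simp add: d_def)
  have d_le: "d \<le> ?v (Suc 0) n" if n: "n \<in> I" for n
  proof -
    have "d \<le> K n j0 * ?v 0 j0"
      unfolding d_def v0 using q(2) n j0(2) by (intro mult_right_mono) simp_all
    also have "\<dots> \<le> ?v (Suc 0) n"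
      unfolding v using v_nonneg by (intro transf_ge_term[OF pos defined _ j0(1) n]) simp_all
    finally show ?thesis .
  qed
  \<comment> \<open>Column minima are attained, hence positive; so \<open>v 1\<close> is bounded away from zero
    and dominates the constants.\<close>
  have ones: "transf_defined I K (\<lambda>_. 1)"
  proof (rule transf_defined_dominated[OF _ defined[of "Suc 0"], of _ "1 / d"])
    show "\<bar>1\<bar> \<le> 1 / d * ?v (Suc 0) n" if "n \<in> I" for n
      using d_le[OF that] d by (simp add: field_simps)
  qed (simp add: pos less_imp_le)
  interpret unimodal_kernel I K s
    by unfold_locales (fact pos s ones preserving SR3)+
  show ?thesis
  proof (induction n)
    case 0
    then show ?case using uni by (simp add: v0)
  next
    case (Suc n)
    have t: "s ^ n \<in> {-1, 1}" using s by (cases "even n") auto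
    have "unimodal I (\<lambda>j. s * s ^ n * (?v (Suc n) j / ?v (Suc (Suc n)) j))"
    proof (rule quotient_step[OF t _ defined v _ defined v])
      show "unimodal I (\<lambda>j. s ^ n * (?v n j / ?v (Suc n) j))" using Suc.IH by simp
    qed (use v_nonneg v_Suc_pos \<open>I \<noteq> {}\<close> in blast)+
    then show ?case by simp
  qed
qed

theorem mainTheorem8:
  fixes I :: "nat set" and K :: "nat \<Rightarrow> nat \<Rightarrow> real" and u :: "nat \<Rightarrow> real"
    and v :: "nat \<Rightarrow> nat \<Rightarrow> real"
  defines "v \<equiv> iterate I K u"
  assumes kernel: "admissible_kernel I K"
    and iterates_defined: "\<And>n. transf_defined I K (v n)"
    and nonconstant: "\<not> constant_seq I u"
  shows "(unimodal I (\<lambda>j. u j - v 1 j) \<longrightarrow>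
            (UP I K \<longrightarrow> (\<forall>n. unimodal I (\<lambda>j. v n j - v (n + 1) j))) \<and>
            (UR I K \<longrightarrow> (\<forall>n. unimodal I (\<lambda>j. (-1) ^ n * (v n j - v (n + 1) j))))) \<and>
         ((\<forall>n\<in>I. \<forall>j\<in>I. K n j > 0) \<and> (\<forall>j\<in>I. u j \<ge> 0) \<and> unimodal I (\<lambda>j. u j / v 1 j) \<longrightarrow>
            (UP I K \<longrightarrow> (\<forall>n. unimodal I (\<lambda>j. v n j / v (n + 1) j))) \<and>
            (UR I K \<longrightarrow> (\<forall>n. unimodal I (\<lambda>j. (-1) ^ n * (v n j / v (n + 1) j)))))"
proof -
  have v: "v n = iterate I K u n" for n by (simp add: v_def)
  note defined = iterates_defined[unfolded v]
  have up: "unimodal I (\<lambda>n. 1 * transf I K f n)"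
    if "UP I K" "unimodal I f" "transf_defined I K f" for f
    using that by (simp_all add: UP_def unimodality_preserving_def)
  have ur: "unimodal I (\<lambda>n. (-1) * transf I K f n)"
    if "UR I K" "unimodal I f" "transf_defined I K f" for f
    using that by (simp_all add: UR_def unimodality_reversing_def)
  have SR3: "SR3 I K" if "UP I K \<or> UR I K"
    using that by (auto simp: UP_def UR_def)
  have i: "unimodal I (\<lambda>j. v n j - v (n + 1) j)"
    if "unimodal I (\<lambda>j. u j - v 1 j)" "UP I K" for n
    using differences_unimodal[OF defined up[OF that(2)] that(1)[unfolded v], of n]
    by (simp add: v)
  have ii: "unimodal I (\<lambda>j. (-1) ^ n * (v n j - v (n + 1) j))"
    if "unimodal I (\<lambda>j. u j - v 1 j)" "UR I K" for n
    using differences_unimodal[OF defined ur[OF that(2)] that(1)[unfolded v], of n]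
    by (simp only: v)
  have iii: "unimodal I (\<lambda>j. v n j / v (n + 1) j)"
    if "\<forall>n\<in>I. \<forall>j\<in>I. K n j > 0" "\<forall>j\<in>I. u j \<ge> 0" "unimodal I (\<lambda>j. u j / v 1 j)" "UP I K" for n
  proof -
    have "unimodal I (\<lambda>j. 1 ^ n * (iterate I K u n j / iterate I K u (n + 1) j))"
      by (rule quotients_unimodal[OF kernel SR3 _ defined up[OF that(4)] nonconstant _ _ that(3)[unfolded v]])
        (use that in simp_all)
    then show ?thesis by (simp add: v)
  qed
  have iv: "unimodal I (\<lambda>j. (-1) ^ n * (v n j / v (n + 1) j))"
    if "\<forall>n\<in>I. \<forall>j\<in>I. K n j > 0" "\<forall>j\<in>I. u j \<ge> 0" "unimodal I (\<lambda>j. u j / v 1 j)" "UR I K" for n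
    unfolding v
    by (rule quotients_unimodal[OF kernel SR3 _ defined ur[OF that(4)] nonconstant _ _ that(3)[unfolded v]])
      (use that in simp_all)
  from i ii iii iv show ?thesis by blast
qed

end
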